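(* Let $(x^l,\mu^l)$ be a solution to the relaxed master problem (RMP), let $d^l\in\mathcal D$ be such that $x^l\in\mathcal X_{d^l}$, and suppose $\mu^l=Q_{d^l}(x^l)$. Let $x^v\in\mathcal X$ with $x^v\ne x^l$, let $d^v$ be such that $x^v\in\mathcal X_{d^v}$, suppose $Q_{d^v}(x^v)$ is finite, and let $\mathcal I^v=\{i\in\{1,\dots,n_1\}:x^v_i=1\}$. Then $(x,\mu)=(x^l,\mu^l)$ satisfies the inequality $$\mu\ge(Q_{d^v}(x^v)-L_{d^v})\Big(\sum_{i\in\mathcal I^v}x_i-\sum_{i\notin\mathcal I^v}x_i\Big)-(Q_{d^v}(x^v)-L_{d^v})(|\mathcal I^v|-1)+L_{d^v}-U(1-\mathbb 1_{d^v}(x)).$$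
   Context: Assumption: $\mathcal X=\{0,1\}^{n_1}$. $\mathcal D$ is finite, $(\mathcal X_d)_{d\in\mathcal D}$ is a partition of $\mathcal X$, $\mathbb 1_d:\mathcal X\to\{0,1\}$ is the characteristic function of $\mathcal X_d$, and $c\in\mathbb R^{n_1}$. For each $d\in\mathcal D$, $\mathsf P_d$ is a probability distribution of the random data $\xi=(q,W,T,h)$, and $Q_d(x)=\mathbb E_{\mathsf P_d}[Q(x,\xi)]$, which for a discrete $\mathsf P_d$ with scenarios $s\in\mathcal S_d$, realizations $\xi_{sd}$ and probabilities $\pi_{sd}$ is $\sum_{s\in\mathcal S_d}\pi_{sd}Q(x,\xi_{sd})$. Here $Q(x,\xi)=\min_y\{q^\top y:Wy=h-Tx,\ y\in\mathcal Y\}$ for a given set $\mathcal Y\subseteq\mathbb R^{n_2}$, possibly imposing integrality restrictions ($+\infty$ if infeasible, $-\infty$ if unbounded). Assumption on $U$ and $L_d$: $L_d$ ($d\in\mathcal D$) are real numbers with $L_d\le\min_{x\in\mathcal X}Q_d(x)$, and $U$ is a constant with $\infty>U\ge\max_{d\in\mathcal D}L_d-\min_{d\in\mathcal D}L_d$. (RMP): given finite sets $\underline{\mathcal F_d},\underline{\mathcal O_d}$ of real-valued functions on $\mathcal X$ ($d\in\mathcal D$), minimize $c^\top x+\mu$ over $x\in\mathcal X$, $\mu\in\mathbb R$ subject to, for every $d\in\mathcal D$: if $x\in\mathcal X_d$ then $f(x)\le0$ for all $f\in\underline{\mathcal F_d}$ and $o(x)\le\mu$ for all $o\in\underline{\mathcal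 O_d}$. A "solution" to (RMP) is a feasible point. *)

theory Defs
  imports "HOL-Probability.Probability"
begin

definition binary_vectors :: "(real ^ 'n) set" where
  "binary_vectors = {x. \<forall>i. x $ i \<in> {0, 1}}"

text \<open>
  The second-stage value, as a function of the first-stage decision and of the data
  (q, W, T, h). As an infimum in the extended reals it is \<open>\<infinity>\<close> if the second-stage
  problem is infeasible and \<open>-\<infinity>\<close> if it is unbounded below.
\<close>

type_synonym ('n1, 'n2, 'm) data =
  "(real ^ 'n2) \<times> (real ^ 'n2 ^ 'm) \<times> (real ^ 'n1 ^ 'm) \<times> (real ^ 'm)"

definition recourse_value ::
  "(real ^ 'n2) set \<Rightarrow> real ^ 'n1 \<Rightarrow> ('n1::finite, 'n2::finite, 'm::finite) data \<Rightarrow> ereal" where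
  "recourse_value Y x \<xi> =
     (case \<xi> of (q, W, T, h) \<Rightarrow> INF y \<in> {y \<in> Y. W *v y = h - T *v x}. ereal (q \<bullet> y))"

text \<open>
  Expectation of an extended-real-valued function, as the difference of the integrals of its
  positive and negative parts. Since \<open>\<infinity> - \<infinity> = \<infinity>\<close> in \<^typ>\<open>ereal\<close>, the value is \<open>\<infinity>\<close> when both
  parts have infinite integral.
\<close>

definition expectation_ereal :: "'a measure \<Rightarrow> ('a \<Rightarrow> ereal) \<Rightarrow> ereal" where
  "expectation_ereal M f =
     enn2ereal (\<integral>\<^sup>+ s. e2ennreal (f s) \<partial>M) - enn2ereal (\<integral>\<^sup>+ s. e2ennreal (- f s) \<partial>M)"

lemma expectation_ereal_finite_pmf:
  assumes "finite (set_pmf p)"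
  shows "expectation_ereal (measure_pmf p) f = (\<Sum>s\<in>set_pmf p. ereal (pmf p s) * f s)"
proof -
  have enn2ereal_e2e: "enn2ereal (e2ennreal z) = max 0 z" for z
    by (cases "0 \<le> z") (auto simp: enn2ereal_e2ennreal e2ennreal_neg max_def zero_ennreal.rep_eq)
  have aux: "enn2ereal (\<Sum>s\<in>A. e2ennreal (f s) * ennreal (w s))
        - enn2ereal (\<Sum>s\<in>A. e2ennreal (- f s) * ennreal (w s))
      = (\<Sum>s\<in>A. ereal (w s) * f s)"
    if "finite A" "\<And>s. s \<in> A \<Longrightarrow> 0 < w s" for A and w :: "'a \<Rightarrow> real"
    using that
  proof (induction A rule: finite_induct)
    case empty
    then show ?case by (simp add: zero_ennreal.rep_eq)
  next
    case (insert s A)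
    let ?a = "enn2ereal (\<Sum>s\<in>A. e2ennreal (f s) * ennreal (w s))"
    let ?b = "enn2ereal (\<Sum>s\<in>A. e2ennreal (- f s) * ennreal (w s))"
    have w: "0 < w s" using insert by simp
    have IH: "?a - ?b = (\<Sum>s\<in>A. ereal (w s) * f s)" using insert by simp
    have nonneg: "0 \<le> ?a" "0 \<le> ?b" by simp_all
    have 1: "enn2ereal (e2ennreal (f s) * ennreal (w s)) = max 0 (f s) * ereal (w s)"
      using w by (simp add: times_ennreal.rep_eq enn2ereal_e2e)
    have 2: "enn2ereal (e2ennreal (- f s) * ennreal (w s)) = max 0 (- f s) * ereal (w s)"
      using w by (simp add: times_ennreal.rep_eq enn2ereal_e2e)
    have "(max 0 (f s) * ereal (w s) + ?a) - (max 0 (- f s) * ereal (w s) + ?b)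
        = ereal (w s) * f s + (?a - ?b)"
      using w nonneg
      by (cases "f s"; cases ?a; cases ?b) (auto simp: max_def mult_neg_pos)
    then show ?case
      using insert IH 1 2 by (simp add: plus_ennreal.rep_eq)
  qed
  show ?thesis
    unfolding expectation_ereal_def
    using assms aux[of "set_pmf p" "pmf p"]
    by (simp add: nn_integral_measure_pmf_finite pmf_positive)
qed

record 'a minimization_problem =
  feasible_set :: "'a set"
  objective :: "'a \<Rightarrow> real"

definition relaxed_master_problem ::
  "real ^ 'n \<Rightarrow> 'd set \<Rightarrow> ('d \<Rightarrow> (real ^ 'n) set) \<Rightarrow>
   ('d \<Rightarrow> (real ^ 'n \<Rightarrow> real) set) \<Rightarrow> ('d \<Rightarrow> (real ^ 'n \<Rightarrow> real) set) \<Rightarrow>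
   ((real ^ 'n) \<times> real) minimization_problem" where
  "relaxed_master_problem c D \<X> F G =
     \<lparr> feasible_set = {(x, \<mu>). x \<in> binary_vectors \<and>
         (\<forall>d\<in>D. x \<in> \<X> d \<longrightarrow> (\<forall>f\<in>F d. f x \<le> 0) \<and> (\<forall>g\<in>G d. g x \<le> \<mu>))},
       objective = (\<lambda>(x, \<mu>). c \<bullet> x + \<mu>) \<rparr>"

end

theory Submission
  imports Defs
begin

text \<open>
  The linear expression in the cut measures Hamming distance: on binary vectors,
  \<open>|I| - (\<Sum>i\<in>I. x i - \<Sum>i\<notin>I. x i)\<close> is the number of coordinates in which \<open>x\<close> differs from the
  indicator vector \<open>v\<close> of \<open>I\<close>. So at every binary \<open>x \<noteq> v\<close> the factor multiplying the nonnegative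
  gap \<open>Q\<^sub>d(v) - L\<^sub>d\<close> is at most \<open>0\<close>, and the cut at such a point asks for no more than
  \<open>\<mu> \<ge> L\<^sub>d - U (1 - \<one>\<^sub>d(x))\<close>.

  At a point where \<open>\<mu>\<close> is the true value, this weak form is implied by the lower bounds \<open>L\<close>. If
  \<open>x\<close> lies in the part of \<open>v\<close>, then \<open>\<mu> = Q\<^sub>d(x) \<ge> L\<^sub>d\<close>. If it lies in another part \<open>d'\<close>, then
  \<open>\<mu> \<ge> L\<^sub>d\<^sub>' \<ge> L\<^sub>d - U\<close>, since \<open>U\<close> dominates the spread of the lower bounds.
\<close>

lemma finite_binary_vectors: "finite (binary_vectors :: (real ^ 'n) set)"
proof (rule finite_subset)
  show "binary_vectors \<subseteq> range (\<lambda>S :: 'n set. \<chi> i. if i \<in> S then 1 else (0::real))"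
  proof
    fix x :: "real ^ 'n" assume "x \<in> binary_vectors"
    then have "x = (\<chi> i. if i \<in> {i. x $ i = 1} then 1 else 0)"
      by (auto simp: binary_vectors_def vec_eq_iff)
    then show "x \<in> range (\<lambda>S :: 'n set. \<chi> i. if i \<in> S then 1 else 0)"
      by blast
  qed
qed simp

text \<open>
  Both sides count the coordinates in which the two vectors differ: one in the support of \<open>v\<close>
  contributes \<open>1 - x i\<close>, one outside it contributes \<open>x i\<close>.
\<close>

lemma sum_abs_diff_binary_vectors:
  fixes x v :: "real ^ 'n"
  assumes "x \<in> binary_vectors" "v \<in> binary_vectors"
  defines "I \<equiv> {i. v $ i = 1}"
  shows "(\<Sum>i\<in>UNIV. \<bar>x $ i - v $ i\<bar>) = real (card I) - ((\<Sum>i\<in>I. x $ i) - (\<Sum>i\<in>- I. x $ i))"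
proof -
  have x: "x $ i = 0 \<or> x $ i = 1" and v: "v $ i = 0 \<or> v $ i = 1" for i
    using assms by (auto simp: binary_vectors_def)
  have on: "\<bar>x $ i - v $ i\<bar> = 1 - x $ i" if "i \<in> I" for i
    using that x[of i] by (auto simp: I_def)
  have off: "\<bar>x $ i - v $ i\<bar> = x $ i" if "i \<in> - I" for i
    using that x[of i] v[of i] by (auto simp: I_def)
  have "(\<Sum>i\<in>UNIV. \<bar>x $ i - v $ i\<bar>)
      = (\<Sum>i\<in>I. \<bar>x $ i - v $ i\<bar>) + (\<Sum>i\<in>- I. \<bar>x $ i - v $ i\<bar>)"
    using sum.union_disjoint[of I "- I" "\<lambda>i. \<bar>x $ i - v $ i\<bar>"] by simp
  also have "\<dots> = (\<Sum>i\<in>I. 1 - x $ i) + (\<Sum>i\<in>- I. x $ i)"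
    using on off by simp
  finally show ?thesis
    by (simp add: sum_subtractf)
qed

text \<open>
  Distinct binary vectors have Hamming distance at least one, which makes this the cut that
  separates \<open>v\<close> from all other binary vectors.
\<close>

lemma no_good_cut:
  fixes x v :: "real ^ 'n"
  assumes "x \<in> binary_vectors" "v \<in> binary_vectors" "x \<noteq> v"
  defines "I \<equiv> {i. v $ i = 1}"
  shows "(\<Sum>i\<in>I. x $ i) - (\<Sum>i\<in>- I. x $ i) \<le> real (card I) - 1"
proof -
  obtain j where "x $ j \<noteq> v $ j"
    using assms by (auto simp: vec_eq_iff)
  moreover have "x $ j \<in> {0, 1}" "v $ j \<in> {0, 1}"
    using assms by (auto simp: binary_vectors_def)
  ultimately have "1 = \<bar>x $ j - v $ j\<bar>"
    by auto
  also have "\<dots> \<le> (\<Sum>i\<in>UNIV. \<bar>x $ i - v $ i\<bar>)"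
    by (rule member_le_sum) auto
  finally show ?thesis
    using sum_abs_diff_binary_vectors[OF assms(1,2)] by (simp add: I_def)
qed

theorem theorem11:
  fixes c :: "real ^ 'n1"
    and D :: "'d set"
    and \<X> :: "'d \<Rightarrow> (real ^ 'n1) set"
    and Y :: "(real ^ 'n2) set"
    and P :: "'d \<Rightarrow> ('n1::finite, 'n2::finite, 'm::finite) data measure"
    and Q :: "'d \<Rightarrow> real ^ 'n1 \<Rightarrow> ereal"
    and L :: "'d \<Rightarrow> real"
    and U :: real
    and F G :: "'d \<Rightarrow> (real ^ 'n1 \<Rightarrow> real) set"
    and xl xv :: "real ^ 'n1"
    and \<mu>l :: real
    and dl dv :: 'd
    and I :: "'n1 set"
  assumes "finite D"
    and "disjoint_family_on \<X> D"
    and "(\<Union>d\<in>D. \<X> d) = binary_vectors"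
    and "\<And>d. d \<in> D \<Longrightarrow> prob_space (P d)"
    and "\<And>d. d \<in> D \<Longrightarrow> sets borel \<subseteq> sets (P d)"
    and "\<And>d x. Q d x = expectation_ereal (P d) (recourse_value Y x)"
    and "\<And>d. d \<in> D \<Longrightarrow> ereal (L d) \<le> (MIN x\<in>binary_vectors. Q d x)"
    and "U \<ge> (MAX d\<in>D. L d) - (MIN d\<in>D. L d)"
    and "\<And>d. d \<in> D \<Longrightarrow> finite (F d)"
    and "\<And>d. d \<in> D \<Longrightarrow> finite (G d)"
    and "(xl, \<mu>l) \<in> feasible_set (relaxed_master_problem c D \<X> F G)"
    and "dl \<in> D" and "xl \<in> \<X> dl"
    and "ereal \<mu>l = Q dl xl"
    and "xv \<in> binary_vectors" and "xv \<noteq> xl"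
    and "dv \<in> D" and "xv \<in> \<X> dv"
    and "\<bar>Q dv xv\<bar> \<noteq> \<infinity>"
    and "I = {i. xv $ i = 1}"
  shows "\<mu>l \<ge> (real_of_ereal (Q dv xv) - L dv) * ((\<Sum>i\<in>I. xl $ i) - (\<Sum>i\<in>- I. xl $ i))
              - (real_of_ereal (Q dv xv) - L dv) * (real (card I) - 1)
              + L dv - U * (1 - indicator (\<X> dv) xl)"
proof -
  have lower: "ereal (L d) \<le> Q d x" if "d \<in> D" "x \<in> binary_vectors" for d x
    using assms(7)[OF that(1)] Min_le[of "Q d ` binary_vectors" "Q d x"] that finite_binary_vectors
    by (meson finite_imageI imageI order_trans)
  have xl: "xl \<in> binary_vectors"
    using assms(3) \<open>dl \<in> D\<close> \<open>xl \<in> \<X> dl\<close> by blast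
  have gap: "0 \<le> real_of_ereal (Q dv xv) - L dv"
    using lower[OF \<open>dv \<in> D\<close> \<open>xv \<in> binary_vectors\<close>] \<open>\<bar>Q dv xv\<bar> \<noteq> \<infinity>\<close>
    by (cases "Q dv xv") auto
  have "ereal (L dl) \<le> ereal \<mu>l"
    using lower[OF \<open>dl \<in> D\<close> xl] \<open>ereal \<mu>l = Q dl xl\<close> by simp
  then have \<mu>l: "L dl \<le> \<mu>l"
    by simp
  have weak: "L dv - U * (1 - indicator (\<X> dv) xl) \<le> \<mu>l"
  proof (cases "xl \<in> \<X> dv")
    case True
    have "dv = dl"
      using assms(2) \<open>dl \<in> D\<close> \<open>dv \<in> D\<close> \<open>xl \<in> \<X> dl\<close> True
      by (auto simp: disjoint_family_on_def)
    then show ?thesis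
      using \<mu>l True by simp
  next
    case False
    have "L dv \<le> (MAX d\<in>D. L d)" "(MIN d\<in>D. L d) \<le> L dl"
      using \<open>finite D\<close> \<open>dv \<in> D\<close> \<open>dl \<in> D\<close> by simp_all
    then show ?thesis
      using \<mu>l assms(8) False by simp
  qed
  have "(real_of_ereal (Q dv xv) - L dv) * ((\<Sum>i\<in>I. xl $ i) - (\<Sum>i\<in>- I. xl $ i))
      \<le> (real_of_ereal (Q dv xv) - L dv) * (real (card I) - 1)"
    using no_good_cut[OF xl \<open>xv \<in> binary_vectors\<close>] \<open>xv \<noteq> xl\<close> gap
    unfolding \<open>I = {i. xv $ i = 1}\<close> by (intro mult_left_mono) auto
  with weak show ?thesis
    by linarith
qed

end
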